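(* Let $k\in\{2,3,4\}$, $\beta>1$, $\Delta t>0$, $T>0$, and fix an ensemble index $j\in\{1,\dots,J\}$. Assume that $\|\mathbf f_{f,j}(t,\cdot)\|,\ \|f_{p,j}(t,\cdot)\|\le C_f$ for all $t$, for some constant $C_f>0$, and choose $C_{r,j}\ge 1$. Then there exist suitable constants $\alpha_j>0$ and $\gamma_j>0$ such that, for the GSAV-GBDF$k$-Ensemble scheme (described in the context) run with these constants, the following hold (with no restriction on the time step $\Delta t$): (i) given $r_j^n>0$, one has $r_j^{n+1}>0$ and $\xi_j^{n+1}>0$; (ii) $$\|\mathbf u_j^{n+1}\|\le M_k,\qquad \|\phi_j^{n+1}\|\le M_k,\qquad \forall\, n+1\le \frac{T}{\Delta t},$$ where $M_k$ is a positive constant that does not depend on the final time $T$.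
   Context: **Domain and data.** $d=2$; $\Omega=\Omega_f\cup\Omega_p\subset\mathbb R^2$ is a bounded domain split into a free-fluid region $\Omega_f$ and a porous-media region $\Omega_p$ with interface $\Gamma$; $\Gamma_f=\partial\Omega_f\setminus\Gamma$, $\Gamma_p=\partial\Omega_p\setminus\Gamma$; $\mathbf n_f$ is the unit outward normal on $\partial\Omega_f$, and $\{\tau_i\}_{i=1}^{d-1}$ are linearly independent unit tangent vectors on $\Gamma$. The constants $\nu,S,\alpha_{BJ},g$ are positive. For $j=1,\dots,J$, $\mathrm K_j(x)$ is a symmetric positive definite tensor on $\Omega_p$ whose minimum eigenvalue $k_{j,\min}(x)$ satisfies $k_{j,\min}=\min_{x\in\Omega_p}k_{j,\min}(x)>0$; $\mathbf f_{f,j}$ and $f_{p,j}$ are source terms on $\Omega_f$ and $\Omega_p$. Set $$\overline{\mathrm K}=\tfrac1J\sum_{j=1}^J\mathrm K_j,\quad \eta_{i,j}=\frac{\alpha_{BJ}\nu\sqrt d}{\sqrt{\tau_i\cdot\mathrm K_j\cdot\tau_i}},\quad \overline\eta_i=\tfrac1J\sum_{j=1}^J\eta_{i,j}.$$ **Spaces and forms.** $X_f=\{\mathbf v\in \mathbf H^1(\Omega_f):\mathbf v|_{\Gamma_f}=0\}$, $X_p=\{\psi\in H^1(\Omega_p):\psi|_{\Gamma_p}=0\}$, $Q_f=L^2(\Omega_f)$. $(\cdot,\cdot)$ and $\|\cdot\|$ are the $L^2$ inner product and norm on $\Omega_f$ or $\Omega_p$ (according to the function), $(\cdot,\cdot)_\Gamma$,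 $\|\cdot\|_\Gamma$ those of $L^2(\Gamma)$. The Poincaré inequalities $\|\mathbf v\|\le C_{p,f}\|\nabla\mathbf v\|$ on $X_f$ and $\|\psi\|\le C_{p,p}\|\nabla\psi\|$ on $X_p$ hold. Define $a(\mathbf u,\mathbf v)=\nu(\nabla\mathbf u,\nabla\mathbf v)$, $b(\mathbf v,p)=(\nabla\cdot\mathbf v,p)$, $d(\mathbf u,\mathbf v,\mathbf w)=((\mathbf u\cdot\nabla)\mathbf v,\mathbf w)-\frac12\int_\Gamma(\mathbf u\cdot\mathbf v)(\mathbf w\cdot\mathbf n_f)\,ds$, and $E_j(\mathbf u,\phi)=\frac12\|\mathbf u\|^2+\frac12 gS\|\phi\|^2$. **Difference operators** (applied to any sequence $u^n$); $A_k^\beta(u^{n+1})=\alpha_k^\beta u^{n+1}+\overline A_k^\beta(u^n)$ and: $k=2$: $\alpha_2^\beta=\frac{2\beta+1}2$, $\overline A_2^\beta(u^n)=-2\beta u^n+\frac{2\beta-1}2u^{n-1}$, $B_2^\beta(u^n)=\beta u^n-(\beta-1)u^{n-1}$, $C_2^\beta(u^n)=(\beta+1)u^n-\beta u^{n-1}$. $k=3$: $\alpha_3^\beta=\frac{3\beta^2+6\beta+2}6$, $\overline A_3^\beta(u^n)=-\frac{9\beta^2+12\beta-3}6u^n+\frac{9\beta^2+6\beta-6}6u^{n-1}-\frac{3\beta^2-1}6u^{n-2}$, $B_3^\beta(u^n)=\frac{\beta^2+\beta}2u^n-(\beta^2-1)u^{n-1}+\frac{\beta^2-\beta}2u^{n-2}$,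 $C_3^\beta(u^n)=\frac{\beta^2+3\beta+2}2u^n-(\beta^2+2\beta)u^{n-1}+\frac{\beta^2+\beta}2u^{n-2}$. $k=4$: $\alpha_4^\beta=\frac{2\beta^3+9\beta^2+11\beta+3}{12}$, $\overline A_4^\beta(u^n)=\frac{-8\beta^3-30\beta^2-20\beta+10}{12}u^n+\frac{12\beta^3+36\beta^2+6\beta-18}{12}u^{n-1}+\frac{-8\beta^3-18\beta^2+4\beta+6}{12}u^{n-2}+\frac{2\beta^3+3\beta^2-\beta-1}{12}u^{n-3}$, $B_4^\beta(u^n)=\frac{\beta^3+3\beta^2+2\beta}6u^n+\frac{-\beta^3-2\beta^2+\beta+2}2u^{n-1}+\frac{\beta^3+\beta^2-2\beta}2u^{n-2}+\frac{-\beta^3+\beta}6u^{n-3}$, $C_4^\beta(u^n)=\frac{\beta^3+6\beta^2+11\beta+6}6u^n+\frac{-\beta^3-5\beta^2-6\beta}2u^{n-1}+\frac{\beta^3+4\beta^2+3\beta}2u^{n-2}+\frac{-\beta^3-3\beta^2-2\beta}6u^{n-3}$. **GSAV-GBDF$k$-Ensemble scheme.** Write $t^s=s\Delta t$, $\mathbf f_{f,j}^{s}=\mathbf f_{f,j}(t^s)$, $f_{p,j}^s=f_{p,j}(t^s)$. The scheme has parameters $\alpha_j,\gamma_j,C_{r,j}>0$. Starting values $\overline{\mathbf u}_j^i,\mathbf u_j^i\in X_f$, $p_j^i\in Q_f$, $\overline\phi_j^i,\phi_j^i\in X_p$ ($0\le i\le k-1$) and $r_j^{k-1}>0$ are given.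 For $n\ge k-1$, find $\overline{\mathbf u}_j^{n+1}\in X_f$, $p_j^{n+1}\in Q_f$, $\overline\phi_j^{n+1}\in X_p$, $r_j^{n+1}\in\mathbb R$, $\mathbf u_j^{n+1}$, $\phi_j^{n+1}$ such that for all $\mathbf v\in X_f$, $q\in Q_f$, $\psi\in X_p$: (1) $\Big(\frac{\alpha_k^\beta\overline{\mathbf u}_j^{n+1}+\overline A_k^\beta(\mathbf u_j^n)}{\Delta t},\mathbf v\Big)+\sum_{i=1}^{d-1}\big(\overline\eta_iB_k^\beta(\overline{\mathbf u}_j^{n+1})\cdot\tau_i,\mathbf v\cdot\tau_i\big)_\Gamma+\sum_{i=1}^{d-1}\big((\eta_{i,j}-\overline\eta_i)C_k^\beta(\overline{\mathbf u}_j^n)\cdot\tau_i,\mathbf v\cdot\tau_i\big)_\Gamma+a(B_k^\beta(\overline{\mathbf u}_j^{n+1}),\mathbf v)+d(C_k^\beta(\overline{\mathbf u}_j^n),C_k^\beta(\overline{\mathbf u}_j^n),\mathbf v)-b(\mathbf v,B_k^\beta(p_j^{n+1}))+(gC_k^\beta(\overline\phi_j^n),\mathbf v\cdot\mathbf n_f)_\Gamma=(\mathbf f_{f,j}^{n+\beta},\mathbf v)$, and $b(B_k^\beta(\overline{\mathbf u}_j^{n+1}),q)=0$; (2) $gS\Big(\frac{\alpha_k^\beta\overline\phi_j^{n+1}+\overline A_k^\beta(\phi_j^n)}{\Delta t},\psi\Big)+g(\overline{\mathrm K}\nabla B_k^\beta(\overline\phi_j^{n+1}),\nabla\psi)+g((\mathrm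 K_j-\overline{\mathrm K})\nabla C_k^\beta(\overline\phi_j^n),\nabla\psi)-(g\psi,C_k^\beta(\overline{\mathbf u}_j^n)\cdot\mathbf n_f)_\Gamma=g(f_{p,j}^{n+\beta},\psi)$; (3) $\frac{r_j^{n+1}-r_j^n}{\Delta t}+\gamma_jr_j^{n+1}=-\frac{r_j^{n+1}}{E_j(\overline{\mathbf u}_j^{n+1},\overline\phi_j^{n+1})+C_{r,j}}\Big\{\nu\|\nabla\overline{\mathbf u}_j^{n+1}\|^2+g\|\sqrt{\mathrm K_j}\nabla\overline\phi_j^{n+1}\|^2+\sum_{i=1}^{d-1}\|\sqrt{\eta_{i,j}}\,\overline{\mathbf u}_j^{n+1}\cdot\tau_i\|_\Gamma^2-(\mathbf f_{f,j}^{n+1},\overline{\mathbf u}_j^{n+1})-(gf_{p,j}^{n+1},\overline\phi_j^{n+1})+\frac{\alpha_j}2(\|\mathbf f_{f,j}^{n+1}\|^2+\|gf_{p,j}^{n+1}\|^2)-\frac{\gamma_j}2(\|\overline{\mathbf u}_j^{n+1}\|^2+gS\|\overline\phi_j^{n+1}\|^2)\Big\}+\frac{\alpha_j}2(\|\mathbf f_{f,j}^{n+1}\|^2+\|gf_{p,j}^{n+1}\|^2)+\gamma_jC_{r,j}$; (4) $\xi_j^{n+1}=\frac{r_j^{n+1}}{E_j(\overline{\mathbf u}_j^{n+1},\overline\phi_j^{n+1})+C_{r,j}}$, $\eta_{k,j}^{n+1}=1-(1-\xi_j^{n+1})^{k+1}$, $\mathbf u_j^{n+1}=\eta_{k,j}^{n+1}\overline{\mathbf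 u}_j^{n+1}$, $\phi_j^{n+1}=\eta_{k,j}^{n+1}\overline\phi_j^{n+1}$. The index $n$ in the theorem ranges over the steps $n\ge k-1$ computed by the scheme. The constant $M_k$ may depend on the starting value of $r_j$. *)

theory Defs
  imports "HOL-Analysis.Analysis"
begin

section \<open>Square-integrable functions\<close>

definition L2 :: "'a measure \<Rightarrow> ('a \<Rightarrow> 'b::euclidean_space) set" where
  "L2 M = {f. f \<in> borel_measurable M \<and> integrable M (\<lambda>x. (norm (f x))\<^sup>2)}"

text \<open>For matrix-valued functions the inner product of \<^typ>\<open>real^2^2\<close> is the Frobenius one.\<close>

definition l2_inner :: "'a measure \<Rightarrow> ('a \<Rightarrow> 'b::euclidean_space) \<Rightarrow> ('a \<Rightarrow> 'b) \<Rightarrow> real" where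
  "l2_inner M f h = (LINT x|M. f x \<bullet> h x)"

definition l2_norm :: "'a measure \<Rightarrow> ('a \<Rightarrow> 'b::euclidean_space) \<Rightarrow> real" where
  "l2_norm M f = sqrt (l2_inner M f f)"

definition l2_tendsto ::
  "'a measure \<Rightarrow> (nat \<Rightarrow> 'a \<Rightarrow> 'b::euclidean_space) \<Rightarrow> ('a \<Rightarrow> 'b) \<Rightarrow> bool" where
  "l2_tendsto M F f \<longleftrightarrow>
     (\<forall>m. (\<lambda>x. F m x - f x) \<in> L2 M) \<and> (\<lambda>m. l2_norm M (\<lambda>x. F m x - f x)) \<longlonglongrightarrow> 0"

section \<open>Arc length on curves in the plane\<close>

text \<open>Arc length is the one-dimensional Hausdorff measure. The set function below is a metric
  outer measure, so its restriction to the Borel sets is countably additive and \<^const>\<open>measure_of\<close>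
  does not degenerate to the null measure.\<close>

definition hausdorff_content :: "real \<Rightarrow> (real^2) set \<Rightarrow> ennreal" where
  "hausdorff_content \<delta> A =
     (INF U \<in> {U :: nat \<Rightarrow> (real^2) set. A \<subseteq> (\<Union>i. U i) \<and> (\<forall>i. bounded (U i) \<and> diameter (U i) \<le> \<delta>)}.
        (\<Sum>i. ennreal (diameter (U i))))"

definition hausdorff_measure_1 :: "(real^2) measure" where
  "hausdorff_measure_1 =
     measure_of UNIV (sets borel) (\<lambda>A. SUP \<delta>\<in>{0<..}. hausdorff_content \<delta> A)"

definition arc_measure :: "(real^2) set \<Rightarrow> (real^2) measure" where
  "arc_measure \<Sigma> = restrict_space hausdorff_measure_1 \<Sigma>"

section \<open>Smooth functions, weak gradients, and traces\<close>

primrec Ck :: "nat \<Rightarrow> (real^2 \<Rightarrow> real) \<Rightarrow> bool" where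
  "Ck 0 f \<longleftrightarrow> continuous_on UNIV f"
| "Ck (Suc m) f \<longleftrightarrow>
     (\<exists>f'. (\<forall>x. (f has_derivative (\<lambda>h. f' x \<bullet> h)) (at x)) \<and> (\<forall>i. Ck m (\<lambda>x. f' x $ i)))"

definition smooth :: "(real^2 \<Rightarrow> real) \<Rightarrow> bool" where
  "smooth f \<longleftrightarrow> (\<forall>m. Ck m f)"

definition grad :: "(real^2 \<Rightarrow> real) \<Rightarrow> real^2 \<Rightarrow> real^2" where
  "grad f x = (\<chi> i. frechet_derivative f (at x) (axis i 1))"

definition test_function :: "(real^2) set \<Rightarrow> (real^2 \<Rightarrow> real) \<Rightarrow> bool" where
  "test_function \<Omega> f \<longleftrightarrow>
     smooth f \<and> compact (closure {x. f x \<noteq> 0}) \<and> closure {x. f x \<noteq> 0} \<subseteq> \<Omega>"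

definition has_weak_gradient ::
  "(real^2) set \<Rightarrow> (real^2 \<Rightarrow> real) \<Rightarrow> (real^2 \<Rightarrow> real^2) \<Rightarrow> bool" where
  "has_weak_gradient \<Omega> w G \<longleftrightarrow>
     (\<forall>f. test_function \<Omega> f \<longrightarrow>
        (LINT x|lebesgue_on \<Omega>. w x *\<^sub>R grad f x) = - (LINT x|lebesgue_on \<Omega>. f x *\<^sub>R G x))"

definition H1 :: "(real^2) set \<Rightarrow> (real^2 \<Rightarrow> real) set" where
  "H1 \<Omega> = {w \<in> L2 (lebesgue_on \<Omega>). \<exists>G \<in> L2 (lebesgue_on \<Omega>). has_weak_gradient \<Omega> w G}"

text \<open>Weak gradients and traces are determined only almost everywhere; \<open>SOME\<close> picks a
  representative.\<close>

definition wgrad :: "(real^2) set \<Rightarrow> (real^2 \<Rightarrow> real) \<Rightarrow> real^2 \<Rightarrow> real^2" where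
  "wgrad \<Omega> w = (SOME G. G \<in> L2 (lebesgue_on \<Omega>) \<and> has_weak_gradient \<Omega> w G)"

text \<open>The trace on the whole boundary, as the limit of the boundary values of smooth functions
  that approximate \<open>w\<close> in \<open>H1\<close>.\<close>

definition has_trace :: "(real^2) set \<Rightarrow> (real^2 \<Rightarrow> real) \<Rightarrow> (real^2 \<Rightarrow> real) \<Rightarrow> bool" where
  "has_trace \<Omega> w b \<longleftrightarrow> b \<in> L2 (arc_measure (frontier \<Omega>)) \<and>
     (\<exists>F :: nat \<Rightarrow> real^2 \<Rightarrow> real. (\<forall>m. smooth (F m)) \<and>
        l2_tendsto (lebesgue_on \<Omega>) F w \<and>
        l2_tendsto (lebesgue_on \<Omega>) (\<lambda>m. grad (F m)) (wgrad \<Omega> w) \<and>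
        l2_tendsto (arc_measure (frontier \<Omega>)) F b)"

definition tr :: "(real^2) set \<Rightarrow> (real^2 \<Rightarrow> real) \<Rightarrow> real^2 \<Rightarrow> real" where
  "tr \<Omega> w = (SOME b. has_trace \<Omega> w b)"

definition H1_vanishing_on :: "(real^2) set \<Rightarrow> (real^2) set \<Rightarrow> (real^2 \<Rightarrow> real) set" where
  "H1_vanishing_on \<Omega> \<Sigma> = {w \<in> H1 \<Omega>. \<exists>b. has_trace \<Omega> w b \<and> (AE x in arc_measure \<Sigma>. b x = 0)}"

text \<open>Row \<open>i\<close> of the gradient of a vector field is the gradient of its \<open>i\<close>-th component, so that
  \<open>(u \<cdot> \<nabla>) v\<close> is \<open>vgrad v *v u\<close>.\<close>

definition vgrad :: "(real^2) set \<Rightarrow> (real^2 \<Rightarrow> real^2) \<Rightarrow> real^2 \<Rightarrow> real^2^2" where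
  "vgrad \<Omega> v x = (\<chi> i. wgrad \<Omega> (\<lambda>y. v y $ i) x)"

definition vdiv :: "(real^2) set \<Rightarrow> (real^2 \<Rightarrow> real^2) \<Rightarrow> real^2 \<Rightarrow> real" where
  "vdiv \<Omega> v x = trace (vgrad \<Omega> v x)"

definition vtr :: "(real^2) set \<Rightarrow> (real^2 \<Rightarrow> real^2) \<Rightarrow> real^2 \<Rightarrow> real^2" where
  "vtr \<Omega> v x = (\<chi> i. tr \<Omega> (\<lambda>y. v y $ i) x)"

text \<open>Near \<open>x\<close> the domain agrees, up to cones of arbitrarily small aperture, with the half-plane
  opposite to \<open>n\<close>. This is the classical outward normal wherever the boundary is differentiable,
  hence almost everywhere on a Lipschitz boundary.\<close>

definition outward_unit_normal :: "(real^2) set \<Rightarrow> real^2 \<Rightarrow> real^2 \<Rightarrow> bool" where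
  "outward_unit_normal \<Omega> x n \<longleftrightarrow> norm n = 1 \<and>
     (\<forall>\<epsilon>>0. \<forall>\<^sub>F y in at x.
        (n \<bullet> (y - x) < - \<epsilon> * norm (y - x) \<longrightarrow> y \<in> \<Omega>) \<and>
        (n \<bullet> (y - x) > \<epsilon> * norm (y - x) \<longrightarrow> y \<notin> \<Omega>))"

section \<open>Symmetric positive definite tensors\<close>

definition sym_pos_def :: "real^2^2 \<Rightarrow> bool" where
  "sym_pos_def A \<longleftrightarrow> transpose A = A \<and> (\<forall>v. v \<noteq> 0 \<longrightarrow> 0 < v \<bullet> (A *v v))"

definition sym_pos_semidef :: "real^2^2 \<Rightarrow> bool" where
  "sym_pos_semidef A \<longleftrightarrow> transpose A = A \<and> (\<forall>v. 0 \<le> v \<bullet> (A *v v))"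

definition min_eigenvalue :: "real^2^2 \<Rightarrow> real" where
  "min_eigenvalue A = Min {l. \<exists>v. v \<noteq> 0 \<and> A *v v = l *\<^sub>R v}"

definition msqrt :: "real^2^2 \<Rightarrow> real^2^2" where
  "msqrt A = (SOME B. sym_pos_semidef B \<and> B ** B = A)"

section \<open>The coupled flow problem\<close>

text \<open>\<open>perm j\<close> is the tensor \<open>K\<^sub>j\<close>, given on the porous region and on the interface. In two
  dimensions there is a single tangent field \<open>tau\<close>, so sums over tangents have one term.\<close>

record flow_data =
  whole :: "(real^2) set"
  fluid :: "(real^2) set"
  porous :: "(real^2) set"
  nf :: "real^2 \<Rightarrow> real^2"
  tau :: "real^2 \<Rightarrow> real^2"
  nu :: real
  stor :: real
  aBJ :: real
  grav :: real
  members :: nat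
  perm :: "nat \<Rightarrow> real^2 \<Rightarrow> real^2^2"
  ff :: "nat \<Rightarrow> real \<Rightarrow> real^2 \<Rightarrow> real^2"
  fp :: "nat \<Rightarrow> real \<Rightarrow> real^2 \<Rightarrow> real"

definition Gam :: "flow_data \<Rightarrow> (real^2) set" where
  "Gam D = frontier (fluid D) \<inter> frontier (porous D)"

definition Gam_f :: "flow_data \<Rightarrow> (real^2) set" where
  "Gam_f D = frontier (fluid D) - Gam D"

definition Gam_p :: "flow_data \<Rightarrow> (real^2) set" where
  "Gam_p D = frontier (porous D) - Gam D"

abbreviation fm :: "flow_data \<Rightarrow> (real^2) measure" where "fm D \<equiv> lebesgue_on (fluid D)"
abbreviation pm :: "flow_data \<Rightarrow> (real^2) measure" where "pm D \<equiv> lebesgue_on (porous D)"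
abbreviation gm :: "flow_data \<Rightarrow> (real^2) measure" where "gm D \<equiv> arc_measure (Gam D)"

definition X_f :: "flow_data \<Rightarrow> (real^2 \<Rightarrow> real^2) set" where
  "X_f D = {v. \<forall>i. (\<lambda>x. v x $ i) \<in> H1_vanishing_on (fluid D) (Gam_f D)}"

definition X_p :: "flow_data \<Rightarrow> (real^2 \<Rightarrow> real) set" where
  "X_p D = H1_vanishing_on (porous D) (Gam_p D)"

definition Q_f :: "flow_data \<Rightarrow> (real^2 \<Rightarrow> real) set" where
  "Q_f D = L2 (fm D)"

definition perm_mean :: "flow_data \<Rightarrow> real^2 \<Rightarrow> real^2^2" where
  "perm_mean D x = (1 / real (members D)) *\<^sub>R (\<Sum>j=1..members D. perm D j x)"

definition eta :: "flow_data \<Rightarrow> nat \<Rightarrow> real^2 \<Rightarrow> real" where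
  "eta D j x = aBJ D * nu D * sqrt 2 / sqrt (tau D x \<bullet> (perm D j x *v tau D x))"

definition eta_mean :: "flow_data \<Rightarrow> real^2 \<Rightarrow> real" where
  "eta_mean D x = (1 / real (members D)) * (\<Sum>j=1..members D. eta D j x)"

text \<open>\<open>whole\<close> is cut by the interface into the two regions. \<open>perm_form\<close> says that the norms
  \<open>\<parallel>\<surd>K\<^sub>j \<nabla>\<psi>\<parallel>\<close>, and with them the forms \<open>(K\<^sub>j \<nabla>\<phi>, \<nabla>\<psi>)\<close>, are finite on \<open>X_p\<close>; it is automatic for
  bounded measurable \<open>K\<^sub>j\<close>.\<close>

locale flow_problem =
  fixes D :: flow_data
  assumes whole: "open (whole D)" "connected (whole D)" "bounded (whole D)"
    and regions: "open (fluid D)" "open (porous D)" "fluid D \<noteq> {}" "porous D \<noteq> {}"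
      "fluid D \<inter> porous D = {}" "whole D - Gam D = fluid D \<union> porous D"
    and normal: "AE x in arc_measure (frontier (fluid D)). outward_unit_normal (fluid D) x (nf D x)"
    and tangent: "AE x in gm D. norm (tau D x) = 1 \<and> tau D x \<bullet> nf D x = 0"
    and constants: "nu D > 0" "stor D > 0" "aBJ D > 0" "grav D > 0" "members D \<ge> 1"
    and perm_spd: "\<And>j x. \<lbrakk>j \<in> {1..members D}; x \<in> porous D \<union> Gam D\<rbrakk> \<Longrightarrow> sym_pos_def (perm D j x)"
    and perm_min: "\<And>j. j \<in> {1..members D} \<Longrightarrow> 0 < (INF x\<in>porous D. min_eigenvalue (perm D j x))"
    and perm_form: "\<And>j \<psi>. \<lbrakk>j \<in> {1..members D}; \<psi> \<in> X_p D\<rbrakk> \<Longrightarrow>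
      (\<lambda>x. msqrt (perm D j x) *v wgrad (porous D) \<psi> x) \<in> L2 (pm D)"
    and poincare_f: "\<exists>C>0. \<forall>v\<in>X_f D. l2_norm (fm D) v \<le> C * l2_norm (fm D) (vgrad (fluid D) v)"
    and poincare_p: "\<exists>C>0. \<forall>\<psi>\<in>X_p D. l2_norm (pm D) \<psi> \<le> C * l2_norm (pm D) (wgrad (porous D) \<psi>)"

definition a_form :: "flow_data \<Rightarrow> (real^2 \<Rightarrow> real^2) \<Rightarrow> (real^2 \<Rightarrow> real^2) \<Rightarrow> real" where
  "a_form D u v = nu D * l2_inner (fm D) (vgrad (fluid D) u) (vgrad (fluid D) v)"

definition b_form :: "flow_data \<Rightarrow> (real^2 \<Rightarrow> real^2) \<Rightarrow> (real^2 \<Rightarrow> real) \<Rightarrow> real" where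
  "b_form D v q = l2_inner (fm D) (vdiv (fluid D) v) q"

definition d_form ::
  "flow_data \<Rightarrow> (real^2 \<Rightarrow> real^2) \<Rightarrow> (real^2 \<Rightarrow> real^2) \<Rightarrow> (real^2 \<Rightarrow> real^2) \<Rightarrow> real" where
  "d_form D u v w =
     l2_inner (fm D) (\<lambda>x. vgrad (fluid D) v x *v u x) w
     - 1/2 * (LINT x|gm D. (vtr (fluid D) u x \<bullet> vtr (fluid D) v x) * (vtr (fluid D) w x \<bullet> nf D x))"

definition energy :: "flow_data \<Rightarrow> (real^2 \<Rightarrow> real^2) \<Rightarrow> (real^2 \<Rightarrow> real) \<Rightarrow> real" where
  "energy D u \<phi> = 1/2 * (l2_norm (fm D) u)\<^sup>2 + 1/2 * grav D * stor D * (l2_norm (pm D) \<phi>)\<^sup>2"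

section \<open>Difference operators\<close>

text \<open>The operators act on a sequence of functions \<open>w\<close> at index \<open>n\<close>; they involve
  \<open>w n, \<dots>, w (n - k + 1)\<close> and are meant for \<open>n + 1 \<ge> k\<close>, where the subtractions on \<^typ>\<open>nat\<close>
  do not truncate. Only \<open>k = 2, 3, 4\<close> are meaningful; the last branch is \<open>k = 4\<close>.\<close>

definition alpha_coeff :: "nat \<Rightarrow> real \<Rightarrow> real" where
  "alpha_coeff k \<beta> =
    (if k = 2 then (2*\<beta> + 1) / 2
     else if k = 3 then (3*\<beta>^2 + 6*\<beta> + 2) / 6
     else (2*\<beta>^3 + 9*\<beta>^2 + 11*\<beta> + 3) / 12)"

definition Abar :: "nat \<Rightarrow> real \<Rightarrow> (nat \<Rightarrow> 'a \<Rightarrow> 'b::real_vector) \<Rightarrow> nat \<Rightarrow> 'a \<Rightarrow> 'b" where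
  "Abar k \<beta> w n x =
    (if k = 2 then
       (- 2*\<beta>) *\<^sub>R w n x + ((2*\<beta> - 1) / 2) *\<^sub>R w (n - 1) x
     else if k = 3 then
       (- (9*\<beta>^2 + 12*\<beta> - 3) / 6) *\<^sub>R w n x + ((9*\<beta>^2 + 6*\<beta> - 6) / 6) *\<^sub>R w (n - 1) x
       - ((3*\<beta>^2 - 1) / 6) *\<^sub>R w (n - 2) x
     else
       ((- 8*\<beta>^3 - 30*\<beta>^2 - 20*\<beta> + 10) / 12) *\<^sub>R w n x
       + ((12*\<beta>^3 + 36*\<beta>^2 + 6*\<beta> - 18) / 12) *\<^sub>R w (n - 1) x
       + ((- 8*\<beta>^3 - 18*\<beta>^2 + 4*\<beta> + 6) / 12) *\<^sub>R w (n - 2) x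
       + ((2*\<beta>^3 + 3*\<beta>^2 - \<beta> - 1) / 12) *\<^sub>R w (n - 3) x)"

definition Bop :: "nat \<Rightarrow> real \<Rightarrow> (nat \<Rightarrow> 'a \<Rightarrow> 'b::real_vector) \<Rightarrow> nat \<Rightarrow> 'a \<Rightarrow> 'b" where
  "Bop k \<beta> w n x =
    (if k = 2 then
       \<beta> *\<^sub>R w n x - (\<beta> - 1) *\<^sub>R w (n - 1) x
     else if k = 3 then
       ((\<beta>^2 + \<beta>) / 2) *\<^sub>R w n x - (\<beta>^2 - 1) *\<^sub>R w (n - 1) x + ((\<beta>^2 - \<beta>) / 2) *\<^sub>R w (n - 2) x
     else
       ((\<beta>^3 + 3*\<beta>^2 + 2*\<beta>) / 6) *\<^sub>R w n x
       + ((- (\<beta>^3) - 2*\<beta>^2 + \<beta> + 2) / 2) *\<^sub>R w (n - 1) x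
       + ((\<beta>^3 + \<beta>^2 - 2*\<beta>) / 2) *\<^sub>R w (n - 2) x
       + ((- (\<beta>^3) + \<beta>) / 6) *\<^sub>R w (n - 3) x)"

definition Cop :: "nat \<Rightarrow> real \<Rightarrow> (nat \<Rightarrow> 'a \<Rightarrow> 'b::real_vector) \<Rightarrow> nat \<Rightarrow> 'a \<Rightarrow> 'b" where
  "Cop k \<beta> w n x =
    (if k = 2 then
       (\<beta> + 1) *\<^sub>R w n x - \<beta> *\<^sub>R w (n - 1) x
     else if k = 3 then
       ((\<beta>^2 + 3*\<beta> + 2) / 2) *\<^sub>R w n x - (\<beta>^2 + 2*\<beta>) *\<^sub>R w (n - 1) x
       + ((\<beta>^2 + \<beta>) / 2) *\<^sub>R w (n - 2) x
     else
       ((\<beta>^3 + 6*\<beta>^2 + 11*\<beta> + 6) / 6) *\<^sub>R w n x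
       + ((- (\<beta>^3) - 5*\<beta>^2 - 6*\<beta>) / 2) *\<^sub>R w (n - 1) x
       + ((\<beta>^3 + 4*\<beta>^2 + 3*\<beta>) / 2) *\<^sub>R w (n - 2) x
       + ((- (\<beta>^3) - 3*\<beta>^2 - 2*\<beta>) / 6) *\<^sub>R w (n - 3) x)"

section \<open>The GSAV-GBDF ensemble scheme\<close>

text \<open>The sequences produced for one member \<open>j\<close> of the ensemble. For given data the members are
  coupled only through \<open>perm_mean\<close> and \<open>eta_mean\<close>, so each can be run on its own.\<close>

record gsav_run =
  velb :: "nat \<Rightarrow> real^2 \<Rightarrow> real^2"
  vel :: "nat \<Rightarrow> real^2 \<Rightarrow> real^2"
  pres :: "nat \<Rightarrow> real^2 \<Rightarrow> real"
  headb :: "nat \<Rightarrow> real^2 \<Rightarrow> real"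
  head :: "nat \<Rightarrow> real^2 \<Rightarrow> real"
  sav :: "nat \<Rightarrow> real"

definition momentum_eq :: "flow_data \<Rightarrow> nat \<Rightarrow> real \<Rightarrow> real \<Rightarrow> nat \<Rightarrow> gsav_run \<Rightarrow> nat \<Rightarrow> bool" where
  "momentum_eq D k \<beta> \<Delta>t j R n \<longleftrightarrow> (\<forall>v\<in>X_f D.
     l2_inner (fm D)
       (\<lambda>x. (1 / \<Delta>t) *\<^sub>R (alpha_coeff k \<beta> *\<^sub>R velb R (n + 1) x + Abar k \<beta> (vel R) n x)) v
     + l2_inner (gm D)
         (\<lambda>x. eta_mean D x * (vtr (fluid D) (Bop k \<beta> (velb R) (n + 1)) x \<bullet> tau D x))
         (\<lambda>x. vtr (fluid D) v x \<bullet> tau D x)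
     + l2_inner (gm D)
         (\<lambda>x. (eta D j x - eta_mean D x) * (vtr (fluid D) (Cop k \<beta> (velb R) n) x \<bullet> tau D x))
         (\<lambda>x. vtr (fluid D) v x \<bullet> tau D x)
     + a_form D (Bop k \<beta> (velb R) (n + 1)) v
     + d_form D (Cop k \<beta> (velb R) n) (Cop k \<beta> (velb R) n) v
     - b_form D v (Bop k \<beta> (pres R) (n + 1))
     + l2_inner (gm D)
         (\<lambda>x. grav D * tr (porous D) (Cop k \<beta> (headb R) n) x)
         (\<lambda>x. vtr (fluid D) v x \<bullet> nf D x)
     = l2_inner (fm D) (ff D j ((real n + \<beta>) * \<Delta>t)) v)"

definition incompressibility_eq :: "flow_data \<Rightarrow> nat \<Rightarrow> real \<Rightarrow> gsav_run \<Rightarrow> nat \<Rightarrow> bool" where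
  "incompressibility_eq D k \<beta> R n \<longleftrightarrow> (\<forall>q\<in>Q_f D. b_form D (Bop k \<beta> (velb R) (n + 1)) q = 0)"

definition darcy_eq :: "flow_data \<Rightarrow> nat \<Rightarrow> real \<Rightarrow> real \<Rightarrow> nat \<Rightarrow> gsav_run \<Rightarrow> nat \<Rightarrow> bool" where
  "darcy_eq D k \<beta> \<Delta>t j R n \<longleftrightarrow> (\<forall>\<psi>\<in>X_p D.
     grav D * stor D * l2_inner (pm D)
       (\<lambda>x. (1 / \<Delta>t) *\<^sub>R (alpha_coeff k \<beta> *\<^sub>R headb R (n + 1) x + Abar k \<beta> (head R) n x)) \<psi>
     + grav D * l2_inner (pm D)
         (\<lambda>x. perm_mean D x *v wgrad (porous D) (Bop k \<beta> (headb R) (n + 1)) x)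
         (wgrad (porous D) \<psi>)
     + grav D * l2_inner (pm D)
         (\<lambda>x. (perm D j x - perm_mean D x) *v wgrad (porous D) (Cop k \<beta> (headb R) n) x)
         (wgrad (porous D) \<psi>)
     - l2_inner (gm D)
         (\<lambda>x. grav D * tr (porous D) \<psi> x)
         (\<lambda>x. vtr (fluid D) (Cop k \<beta> (velb R) n) x \<bullet> nf D x)
     = grav D * l2_inner (pm D) (fp D j ((real n + \<beta>) * \<Delta>t)) \<psi>)"

text \<open>\<open>xi\<close> and \<open>eta_k\<close> at index \<open>n\<close> are the quantities with superscript \<open>n\<close>; so is \<open>braces\<close>, the
  expression in curly braces in the equation for the auxiliary variable.\<close>

definition xi :: "flow_data \<Rightarrow> real \<Rightarrow> gsav_run \<Rightarrow> nat \<Rightarrow> real" where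
  "xi D Cr R n = sav R n / (energy D (velb R n) (headb R n) + Cr)"

definition eta_k :: "flow_data \<Rightarrow> nat \<Rightarrow> real \<Rightarrow> gsav_run \<Rightarrow> nat \<Rightarrow> real" where
  "eta_k D k Cr R n = 1 - (1 - xi D Cr R n) ^ (k + 1)"

definition source_term :: "flow_data \<Rightarrow> real \<Rightarrow> real \<Rightarrow> nat \<Rightarrow> nat \<Rightarrow> real" where
  "source_term D \<Delta>t \<alpha> j n =
     \<alpha> / 2 * ((l2_norm (fm D) (ff D j (real n * \<Delta>t)))\<^sup>2
       + (l2_norm (pm D) (\<lambda>x. grav D * fp D j (real n * \<Delta>t) x))\<^sup>2)"

definition braces ::
  "flow_data \<Rightarrow> real \<Rightarrow> real \<Rightarrow> real \<Rightarrow> nat \<Rightarrow> gsav_run \<Rightarrow> nat \<Rightarrow> real" where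
  "braces D \<Delta>t \<alpha> \<gamma> j R n =
     nu D * (l2_norm (fm D) (vgrad (fluid D) (velb R n)))\<^sup>2
     + grav D * (l2_norm (pm D) (\<lambda>x. msqrt (perm D j x) *v wgrad (porous D) (headb R n) x))\<^sup>2
     + (l2_norm (gm D) (\<lambda>x. sqrt (eta D j x) * (vtr (fluid D) (velb R n) x \<bullet> tau D x)))\<^sup>2
     - l2_inner (fm D) (ff D j (real n * \<Delta>t)) (velb R n)
     - l2_inner (pm D) (\<lambda>x. grav D * fp D j (real n * \<Delta>t) x) (headb R n)
     + source_term D \<Delta>t \<alpha> j n
     - \<gamma> / 2 * ((l2_norm (fm D) (velb R n))\<^sup>2 + grav D * stor D * (l2_norm (pm D) (headb R n))\<^sup>2)"

definition sav_eq ::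
  "flow_data \<Rightarrow> real \<Rightarrow> real \<Rightarrow> real \<Rightarrow> real \<Rightarrow> nat \<Rightarrow> gsav_run \<Rightarrow> nat \<Rightarrow> bool" where
  "sav_eq D \<Delta>t \<alpha> \<gamma> Cr j R n \<longleftrightarrow>
     (sav R (n + 1) - sav R n) / \<Delta>t + \<gamma> * sav R (n + 1)
     = - (sav R (n + 1) / (energy D (velb R (n + 1)) (headb R (n + 1)) + Cr))
         * braces D \<Delta>t \<alpha> \<gamma> j R (n + 1)
       + source_term D \<Delta>t \<alpha> j (n + 1) + \<gamma> * Cr"

definition gsav_step ::
  "flow_data \<Rightarrow> nat \<Rightarrow> real \<Rightarrow> real \<Rightarrow> real \<Rightarrow> real \<Rightarrow> real \<Rightarrow> nat \<Rightarrow> gsav_run \<Rightarrow> nat \<Rightarrow> bool" where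
  "gsav_step D k \<beta> \<Delta>t \<alpha> \<gamma> Cr j R n \<longleftrightarrow>
     velb R (n + 1) \<in> X_f D \<and> pres R (n + 1) \<in> Q_f D \<and> headb R (n + 1) \<in> X_p D \<and>
     momentum_eq D k \<beta> \<Delta>t j R n \<and>
     incompressibility_eq D k \<beta> R n \<and>
     darcy_eq D k \<beta> \<Delta>t j R n \<and>
     sav_eq D \<Delta>t \<alpha> \<gamma> Cr j R n \<and>
     (AE x in fm D. vel R (n + 1) x = eta_k D k Cr R (n + 1) *\<^sub>R velb R (n + 1) x) \<and>
     (AE x in pm D. head R (n + 1) x = eta_k D k Cr R (n + 1) * headb R (n + 1) x)"

definition gsav_start :: "flow_data \<Rightarrow> nat \<Rightarrow> gsav_run \<Rightarrow> bool" where
  "gsav_start D k R \<longleftrightarrow>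
     (\<forall>i\<le>k - 1. velb R i \<in> X_f D \<and> vel R i \<in> X_f D \<and> pres R i \<in> Q_f D
        \<and> headb R i \<in> X_p D \<and> head R i \<in> X_p D)
     \<and> sav R (k - 1) > 0"

text \<open>All steps \<open>n \<ge> k - 1\<close> up to the final time \<open>T\<close> have been computed.\<close>

definition gsav_scheme ::
  "flow_data \<Rightarrow> nat \<Rightarrow> real \<Rightarrow> real \<Rightarrow> real \<Rightarrow> real \<Rightarrow> real \<Rightarrow> real \<Rightarrow> nat \<Rightarrow> gsav_run \<Rightarrow> bool" where
  "gsav_scheme D k \<beta> \<Delta>t T \<alpha> \<gamma> Cr j R \<longleftrightarrow>
     gsav_start D k R \<and>
     (\<forall>n\<ge>k - 1. real (n + 1) \<le> T / \<Delta>t \<longrightarrow> gsav_step D k \<beta> \<Delta>t \<alpha> \<gamma> Cr j R n)"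

end

theory Submission
  imports Defs
begin

text \<open>Young's inequality, the Poincare inequalities and the uniform ellipticity of the tensor
  make the expression in braces nonnegative once \<open>1 / \<alpha>\<close> and \<open>\<gamma>\<close> are small. The equation for the
  auxiliary variable then reads \<open>r' (1 + \<gamma> \<Delta>t + nonneg) = r + \<Delta>t (source + \<gamma> C\<^sub>r)\<close>, so \<open>r\<close> stays
  positive and below a bound independent of time. Since \<open>\<bar>\<eta>\<^sub>k\<bar> \<le> K \<xi>\<close> and \<open>\<xi> = r / (E + C\<^sub>r)\<close>, the
  quadratic growth of the energy \<open>E\<close> absorbs the norms of the uncorrected solution.\<close>

section \<open>Square-integrable functions\<close>

lemma l2_norm_nonneg: "0 \<le> l2_norm M f"
  by (simp add: l2_norm_def l2_inner_def)

lemma l2_norm_power2: "(l2_norm M f)\<^sup>2 = (LINT x|M. (norm (f x))\<^sup>2)"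
  by (simp add: l2_norm_def l2_inner_def power2_norm_eq_inner)

lemma l2_norm_mult:
  fixes f :: "'a \<Rightarrow> real"
  shows "l2_norm M (\<lambda>x. c * f x) = \<bar>c\<bar> * l2_norm M f"
proof -
  have "(LINT x|M. (c * f x) * (c * f x)) = c\<^sup>2 * (LINT x|M. f x * f x)"
    by (subst integral_mult_right_zero[symmetric]) (simp add: power2_eq_square algebra_simps)
  then show ?thesis
    by (simp add: l2_norm_def l2_inner_def real_sqrt_mult)
qed

text \<open>Only an inequality: \<open>f\<close> need not be measurable, and then its \<open>l2_norm\<close> is \<open>0\<close>.\<close>

lemma l2_norm_AE_scaleR_le:
  fixes f h :: "'a \<Rightarrow> 'b::euclidean_space"
  assumes "AE x in M. f x = c *\<^sub>R h x" "integrable M (\<lambda>x. (norm (h x))\<^sup>2)"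
  shows "l2_norm M f \<le> \<bar>c\<bar> * l2_norm M h"
proof -
  have "(LINT x|M. (norm (f x))\<^sup>2) \<le> c\<^sup>2 * (LINT x|M. (norm (h x))\<^sup>2)"
  proof (cases "integrable M (\<lambda>x. (norm (f x))\<^sup>2)")
    case True
    have "(LINT x|M. (norm (f x))\<^sup>2) = (LINT x|M. c\<^sup>2 * (norm (h x))\<^sup>2)"
      using True assms
      by (intro integral_cong_AE) (auto elim!: eventually_mono simp: power_mult_distrib)
    then show ?thesis by simp
  next
    case False
    then show ?thesis by (simp add: not_integrable_integral_eq)
  qed
  then have "(l2_norm M f)\<^sup>2 \<le> (\<bar>c\<bar> * l2_norm M h)\<^sup>2"
    by (simp add: l2_norm_power2 power_mult_distrib)
  then show ?thesis
    by (rule power2_le_imp_le) (simp add: l2_norm_nonneg)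
qed

lemma l2_inner_young:
  fixes f h :: "'a \<Rightarrow> 'b::euclidean_space"
  assumes "integrable M (\<lambda>x. (norm (f x))\<^sup>2)" "integrable M (\<lambda>x. (norm (h x))\<^sup>2)" "a > 0"
  shows "l2_inner M f h \<le> a / 2 * (l2_norm M f)\<^sup>2 + 1 / (2 * a) * (l2_norm M h)\<^sup>2"
proof -
  have pw: "u \<bullet> v \<le> a / 2 * (norm u)\<^sup>2 + 1 / (2 * a) * (norm v)\<^sup>2" for u v :: 'b
  proof -
    have "0 \<le> (norm (a *\<^sub>R u - v))\<^sup>2"
      by simp
    also have "\<dots> = a\<^sup>2 * (norm u)\<^sup>2 - 2 * a * (u \<bullet> v) + (norm v)\<^sup>2"
      unfolding power2_norm_eq_inner
      by (simp add: inner_diff_left inner_diff_right inner_commute power2_eq_square algebra_simps)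
    finally show ?thesis
      using \<open>a > 0\<close> by (simp add: field_simps power2_eq_square)
  qed
  \<comment> \<open>If \<open>f x \<bullet> h x\<close> fails to be integrable, its integral is 0,
    which the nonnegative majorant still bounds. Hence only the majorant has to be
    integrable.\<close>
  have "l2_inner M f h \<le> (LINT x|M. a / 2 * (norm (f x))\<^sup>2 + 1 / (2 * a) * (norm (h x))\<^sup>2)"
    unfolding l2_inner_def using assms pw by (intro integral_mono') auto
  also have "\<dots> = a / 2 * (l2_norm M f)\<^sup>2 + 1 / (2 * a) * (l2_norm M h)\<^sup>2"
    using assms by (simp add: l2_norm_power2)
  finally show ?thesis .
qed

lemma X_f_square_integrable:
  assumes "v \<in> X_f D"
  shows "integrable (fm D) (\<lambda>x. (norm (v x))\<^sup>2)"
proof -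
  have "integrable (fm D) (\<lambda>x. (v x $ i)\<^sup>2)" for i
    using assms by (auto simp: X_f_def H1_vanishing_on_def H1_def L2_def)
  then have "integrable (fm D) (\<lambda>x. \<Sum>i\<in>UNIV. (v x $ i)\<^sup>2)"
    by (intro Bochner_Integration.integrable_sum)
  then show ?thesis
    by (simp add: norm_vec_def L2_set_def sum_nonneg)
qed

lemma X_p_square_integrable:
  assumes "\<psi> \<in> X_p D"
  shows "integrable (pm D) (\<lambda>x. (norm (\<psi> x))\<^sup>2)"
  using assms by (auto simp: X_p_def H1_vanishing_on_def H1_def L2_def)

section \<open>Symmetric positive definite tensors in the plane\<close>

text \<open>The easy half of Sylvester's criterion: the quadratic form is tested on the two unit
  vectors and on one vector orthogonal to the first row.\<close>

lemma sym_pos_def_entries: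
  assumes "sym_pos_def A"
  shows "A$2$1 = A$1$2" "A$1$1 > 0" "A$2$2 > 0" "A$1$1 * A$2$2 - (A$1$2)\<^sup>2 > 0"
proof -
  have "transpose A $ 1 $ 2 = A $ 1 $ 2"
    using assms by (simp add: sym_pos_def_def)
  then show sym: "A$2$1 = A$1$2"
    by (simp add: transpose_def)
  have pos: "0 < v$1 * (A$1$1 * v$1 + A$1$2 * v$2) + v$2 * (A$1$2 * v$1 + A$2$2 * v$2)"
    if "v \<noteq> 0" for v :: "real^2"
  proof -
    have "0 < v \<bullet> (A *v v)"
      using assms that by (simp add: sym_pos_def_def)
    then show ?thesis
      by (simp add: inner_vec_def matrix_vector_mult_def sum_2 sym)
  qed
  show a: "A$1$1 > 0"
    using pos[of "vector [1, 0]"] by (simp add: vec_eq_iff forall_2)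
  show "A$2$2 > 0"
    using pos[of "vector [0, 1]"] by (simp add: vec_eq_iff forall_2)
  \<comment> \<open>The test vector is orthogonal to the first row of \<open>A\<close>, so the form
    there equals \<open>A$1$1\<close> times the determinant.\<close>
  have "0 < A$1$1 * (A$1$1 * A$2$2 - (A$1$2)\<^sup>2)"
    using pos[of "vector [A$1$2, - A$1$1]"] a
    by (simp add: vec_eq_iff forall_2 power2_eq_square algebra_simps)
  then show "A$1$1 * A$2$2 - (A$1$2)\<^sup>2 > 0"
    using a by (simp add: zero_less_mult_iff)
qed

text \<open>By Cayley--Hamilton \<open>(A + s)\<^sup>2 = (tr A + 2 s) A\<close> for \<open>s = sqrt (det A)\<close>, which gives the square
  root explicitly.\<close>

lemma sym_pos_semidef_sqrt_exists:
  assumes "sym_pos_def A"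
  shows "\<exists>B. sym_pos_semidef B \<and> B ** B = A"
proof -
  note A = sym_pos_def_entries[OF assms]
  define s where "s = sqrt (A$1$1 * A$2$2 - (A$1$2)\<^sup>2)"
  have s: "s > 0" "s\<^sup>2 = A$1$1 * A$2$2 - (A$1$2)\<^sup>2"
    using A by (simp_all add: s_def)
  \<comment> \<open>\<open>t\<close> is the trace of the root \<open>B\<close> constructed
    below.\<close>
  define t where "t = sqrt (A$1$1 + A$2$2 + 2 * s)"
  have t: "t > 0" "t\<^sup>2 = A$1$1 + A$2$2 + 2 * s"
    using A s by (simp_all add: t_def)
  define B where "B = (1 / t) *\<^sub>R (A + s *\<^sub>R mat 1)"
  have "transpose B = B"
    using A(1) by (simp add: B_def vec_eq_iff transpose_def mat_def forall_2)
  moreover have "0 \<le> v \<bullet> (B *v v)" for v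
  proof -
    have "v \<bullet> (B *v v) = (1 / t) * (v \<bullet> (A *v v) + s * (v \<bullet> v))"
      by (simp add: B_def inner_vec_def matrix_vector_mult_def sum_2 mat_def add_divide_distrib algebra_simps)
    moreover have "0 \<le> v \<bullet> (A *v v)"
      using assms by (cases "v = 0") (auto simp: sym_pos_def_def less_imp_le)
    ultimately show ?thesis
      using s t by simp
  qed
  moreover have "B ** B = A"
  proof -
    have "(A + s *\<^sub>R mat 1) ** (A + s *\<^sub>R mat 1) = t\<^sup>2 *\<^sub>R A"
      unfolding t(2) using A(1) s(2)
      by (simp add: vec_eq_iff forall_2 matrix_matrix_mult_def sum_2 mat_def power2_eq_square
          algebra_simps)
    then show ?thesis
      using t(1) by (simp add: B_def matrix_scalar_ac scalar_matrix_assoc[symmetric]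
          power2_eq_square)
  qed
  ultimately show ?thesis
    unfolding sym_pos_semidef_def by blast
qed

text \<open>Every symmetric root \<open>B\<close> of \<open>A\<close> satisfies
  \<open>B\<^sup>T B = A\<close>, so the value does not depend on which root \<open>SOME\<close>
  picks in \<open>msqrt\<close>.\<close>

lemma norm_msqrt_power2:
  assumes "sym_pos_def A"
  shows "(norm (msqrt A *v v))\<^sup>2 = v \<bullet> (A *v v)"
proof -
  have B: "sym_pos_semidef (msqrt A) \<and> msqrt A ** msqrt A = A"
    unfolding msqrt_def by (rule someI_ex) (rule sym_pos_semidef_sqrt_exists[OF assms])
  have "(norm (msqrt A *v v))\<^sup>2 = v \<bullet> ((transpose (msqrt A) ** msqrt A) *v v)"
    by (simp add: power2_norm_eq_inner dot_lmul_matrix[symmetric] matrix_vector_mul_assoc[symmetric]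
        inner_commute)
  then show ?thesis
    using B by (simp add: sym_pos_semidef_def)
qed

text \<open>The characteristic equation: \<open>l\<close> is an eigenvalue exactly when
  \<open>A - l\<close> has a nontrivial kernel, that is, determinant 0.\<close>

lemma eigenvalue_2x2_iff:
  fixes A :: "real^2^2"
  shows "(\<exists>v. v \<noteq> 0 \<and> A *v v = l *\<^sub>R v) \<longleftrightarrow> (A$1$1 - l) * (A$2$2 - l) = A$1$2 * A$2$1"
proof -
  have "(\<exists>v. v \<noteq> 0 \<and> A *v v = l *\<^sub>R v) \<longleftrightarrow> (\<exists>v. v \<noteq> 0 \<and> (A - l *\<^sub>R mat 1) *v v = 0)"
    by (simp add: matrix_vector_mult_diff_rdistrib scaleR_matrix_vector_assoc[symmetric])
  also have "\<dots> \<longleftrightarrow> det (A - l *\<^sub>R mat 1) = 0"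
    using matrix_left_invertible_ker[of "A - l *\<^sub>R mat 1"] invertible_left_inverse invertible_det_nz
    by blast
  also have "\<dots> \<longleftrightarrow> (A$1$1 - l) * (A$2$2 - l) = A$1$2 * A$2$1"
    by (simp add: det_2 mat_def)
  finally show ?thesis .
qed

text \<open>Solving the characteristic equation explicitly shows that the set of eigenvalues is
  finite and nonempty, which gives \<open>Min\<close> its meaning. The Rayleigh bound follows
  because \<open>A - m\<close> is semidefinite for the smaller root \<open>m\<close>.\<close>

lemma min_eigenvalue_sym_pos_def:
  assumes "sym_pos_def A"
  shows "0 < min_eigenvalue A" and "min_eigenvalue A * (norm v)\<^sup>2 \<le> v \<bullet> (A *v v)"
proof -
  note A = sym_pos_def_entries[OF assms]
  let ?L = "{l. \<exists>v. v \<noteq> 0 \<and> A *v v = l *\<^sub>R v}"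
  let ?a = "A$1$1" and ?b = "A$1$2" and ?c = "A$2$2"
  \<comment> \<open>\<open>d\<close> is half the gap between the two eigenvalues; \<open>m\<close>
    is the smaller one.\<close>
  define d where "d = sqrt (((?a - ?c) / 2)\<^sup>2 + ?b\<^sup>2)"
  define m where "m = (?a + ?c) / 2 - d"
  have d: "d\<^sup>2 = ((?a - ?c) / 2)\<^sup>2 + ?b\<^sup>2"
    by (simp add: d_def)
  have "(?a - l) * (?c - l) - ?b * A$2$1 = (l - m) * (l - ((?a + ?c) / 2 + d))" for l
  proof -
    have "(l - m) * (l - ((?a + ?c) / 2 + d)) = (l - (?a + ?c) / 2)\<^sup>2 - d\<^sup>2"
      by (simp add: m_def power2_eq_square field_simps)
    also have "\<dots> = (?a - l) * (?c - l) - ?b * A$2$1"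
      unfolding d A(1) by (simp add: power2_eq_square field_simps)
    finally show ?thesis ..
  qed
  then have "l \<in> ?L \<longleftrightarrow> l \<in> {m, (?a + ?c) / 2 + d}" for l
    unfolding mem_Collect_eq eigenvalue_2x2_iff by (smt (verit) insert_iff mult_eq_0_iff singletonD)
  then have L: "?L = {m, (?a + ?c) / 2 + d}"
    by blast
  then have fin: "finite ?L" and mL: "m \<in> ?L"
    by auto
  have "min_eigenvalue A \<in> ?L"
    unfolding min_eigenvalue_def using fin mL by (intro Min_in) auto
  then obtain w where w: "w \<noteq> 0" "A *v w = min_eigenvalue A *\<^sub>R w"
    by blast
  then have "0 < min_eigenvalue A * (w \<bullet> w)"
    using assms by (metis inner_scaleR_right sym_pos_def_def)
  then show "0 < min_eigenvalue A"
    using w(1) by (metis inner_gt_zero_iff zero_less_mult_pos2)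
  have le: "min_eigenvalue A \<le> m"
    unfolding min_eigenvalue_def using fin mL by (rule Min_le)
  have "\<bar>(?a - ?c) / 2\<bar> \<le> d"
    unfolding d_def by (intro real_le_rsqrt) (simp add: power_divide)
  then have ac: "0 \<le> ?a - m" "0 \<le> ?c - m"
    by (auto simp: m_def abs_le_iff field_simps)
  \<comment> \<open>\<open>A - m\<close> is singular. Together with its nonnegative diagonal this
    makes it semidefinite: the off-diagonal entry is, up to sign, the geometric mean of the diagonal
    ones, so the cross term is controlled by the inequality of the means.\<close>
  have prod: "(?a - m) * (?c - m) = ?b\<^sup>2"
    using mL unfolding mem_Collect_eq eigenvalue_2x2_iff by (simp add: A(1) power2_eq_square)
  have "0 \<le> (?a - m) * x\<^sup>2 + 2 * ?b * x * y + (?c - m) * y\<^sup>2" for x y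
  proof -
    have "\<bar>?b\<bar> = sqrt (?a - m) * sqrt (?c - m)"
      using prod by (metis real_sqrt_abs real_sqrt_mult)
    then have "\<bar>2 * ?b * x * y\<bar> = 2 * (sqrt (?a - m) * \<bar>x\<bar>) * (sqrt (?c - m) * \<bar>y\<bar>)"
      by (simp add: abs_mult)
    also have "\<dots> \<le> (sqrt (?a - m) * \<bar>x\<bar>)\<^sup>2 + (sqrt (?c - m) * \<bar>y\<bar>)\<^sup>2"
      by (rule sum_squares_bound)
    finally show ?thesis
      using ac by (simp add: power_mult_distrib)
  qed
  from this[of "v$1" "v$2"] have "m * (norm v)\<^sup>2 \<le> v \<bullet> (A *v v)"
    unfolding power2_norm_eq_inner
    by (simp add: inner_vec_def matrix_vector_mult_def sum_2 A(1) power2_eq_square algebra_simps)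
  moreover have "min_eigenvalue A * (norm v)\<^sup>2 \<le> m * (norm v)\<^sup>2"
    using le by (rule mult_right_mono) simp
  ultimately show "min_eigenvalue A * (norm v)\<^sup>2 \<le> v \<bullet> (A *v v)"
    by linarith
qed

section \<open>Coercivity\<close>

context flow_problem
begin

lemma perm_coercive:
  assumes "j \<in> {1..members D}" "\<psi> \<in> X_p D"
  shows "(INF x\<in>porous D. min_eigenvalue (perm D j x)) * (l2_norm (pm D) (wgrad (porous D) \<psi>))\<^sup>2
    \<le> (l2_norm (pm D) (\<lambda>x. msqrt (perm D j x) *v wgrad (porous D) \<psi> x))\<^sup>2"
proof -
  define \<kappa> where "\<kappa> = (INF x\<in>porous D. min_eigenvalue (perm D j x))"
  have spd: "sym_pos_def (perm D j x)" if "x \<in> porous D" for x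
    using perm_spd assms(1) that by blast
  \<comment> \<open>On the reals \<open>INF\<close> is a lower bound only for a family bounded
    below; positivity of the eigenvalues provides this.\<close>
  have "bdd_below ((\<lambda>x. min_eigenvalue (perm D j x)) ` porous D)"
    using spd min_eigenvalue_sym_pos_def(1) by (intro bdd_belowI2[of _ 0]) (auto intro: less_imp_le)
  then have \<kappa>: "\<kappa> \<le> min_eigenvalue (perm D j x)" if "x \<in> porous D" for x
    unfolding \<kappa>_def using that by (rule cINF_lower)
  have "\<kappa> * (norm v)\<^sup>2 \<le> (norm (msqrt (perm D j x) *v v))\<^sup>2" if "x \<in> porous D" for x v
    using mult_right_mono[OF \<kappa>[OF that], of "(norm v)\<^sup>2"]
      min_eigenvalue_sym_pos_def(2)[OF spd[OF that], of v]
    by (simp add: norm_msqrt_power2[OF spd[OF that]])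
  \<comment> \<open>The pointwise bound is integrated; \<open>perm_form\<close> makes the larger
    side integrable.\<close>
  then have "(LINT x|pm D. \<kappa> * (norm (wgrad (porous D) \<psi> x))\<^sup>2)
      \<le> (LINT x|pm D. (norm (msqrt (perm D j x) *v wgrad (porous D) \<psi> x))\<^sup>2)"
    using perm_form[OF assms] by (intro integral_mono') (auto simp: L2_def)
  then show ?thesis
    by (simp add: l2_norm_power2 \<kappa>_def)
qed

text \<open>The Poincare inequalities are squared and, on the porous side, combined with
  ellipticity. A single \<open>m\<close> for both regions lets one \<open>\<alpha>\<close> serve
  both source terms.\<close>

lemma coercive:
  assumes "j \<in> {1..members D}"
  obtains m where "m > 0"
    "\<And>v. v \<in> X_f D \<Longrightarrow> m * (l2_norm (fm D) v)\<^sup>2 \<le> nu D * (l2_norm (fm D) (vgrad (fluid D) v))\<^sup>2"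
    "\<And>\<psi>. \<psi> \<in> X_p D \<Longrightarrow> m * (l2_norm (pm D) \<psi>)\<^sup>2
       \<le> grav D * (l2_norm (pm D) (\<lambda>x. msqrt (perm D j x) *v wgrad (porous D) \<psi> x))\<^sup>2"
proof -
  have poincare_square: "m * a\<^sup>2 \<le> \<mu> * b\<^sup>2"
    if "m \<le> \<mu> / C\<^sup>2" "0 \<le> m" "0 < C" "0 \<le> a" "a \<le> C * b" for m \<mu> C a b :: real
  proof -
    have "m * a\<^sup>2 \<le> m * (C * b)\<^sup>2"
      using that by (intro mult_left_mono power_mono) auto
    also have "\<dots> = (m * C\<^sup>2) * b\<^sup>2"
      by (simp add: power_mult_distrib)
    also have "\<dots> \<le> \<mu> * b\<^sup>2"
      using that by (intro mult_right_mono) (auto simp: field_simps)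
    finally show ?thesis .
  qed
  obtain Cf where Cf: "Cf > 0"
    "\<And>v. v \<in> X_f D \<Longrightarrow> l2_norm (fm D) v \<le> Cf * l2_norm (fm D) (vgrad (fluid D) v)"
    using poincare_f by blast
  obtain Cp where Cp: "Cp > 0"
    "\<And>\<psi>. \<psi> \<in> X_p D \<Longrightarrow> l2_norm (pm D) \<psi> \<le> Cp * l2_norm (pm D) (wgrad (porous D) \<psi>)"
    using poincare_p by blast
  define \<kappa> where "\<kappa> = (INF x\<in>porous D. min_eigenvalue (perm D j x))"
  define m where "m = min (nu D / Cf\<^sup>2) (grav D * \<kappa> / Cp\<^sup>2)"
  have "\<kappa> > 0"
    unfolding \<kappa>_def using perm_min[OF assms] .
  then have "m > 0"
    using constants Cf(1) Cp(1) by (simp add: m_def)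
  moreover have "m * (l2_norm (fm D) v)\<^sup>2 \<le> nu D * (l2_norm (fm D) (vgrad (fluid D) v))\<^sup>2"
    if "v \<in> X_f D" for v
    using Cf(1) Cf(2)[OF that] \<open>m > 0\<close>
    by (intro poincare_square[of m _ Cf]) (auto simp: m_def l2_norm_nonneg)
  moreover have "m * (l2_norm (pm D) \<psi>)\<^sup>2
       \<le> grav D * (l2_norm (pm D) (\<lambda>x. msqrt (perm D j x) *v wgrad (porous D) \<psi> x))\<^sup>2"
    if "\<psi> \<in> X_p D" for \<psi>
  proof -
    have "m * (l2_norm (pm D) \<psi>)\<^sup>2 \<le> (grav D * \<kappa>) * (l2_norm (pm D) (wgrad (porous D) \<psi>))\<^sup>2"
      using Cp(1) Cp(2)[OF that] \<open>m > 0\<close>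
      by (intro poincare_square[of m _ Cp]) (auto simp: m_def l2_norm_nonneg)
    also have "\<dots> \<le> grav D * (l2_norm (pm D) (\<lambda>x. msqrt (perm D j x) *v wgrad (porous D) \<psi> x))\<^sup>2"
      using mult_left_mono[OF perm_coercive[OF assms that], of "grav D"] constants
      by (simp add: \<kappa>_def mult.assoc)
    finally show ?thesis .
  qed
  ultimately show ?thesis
    using that by blast
qed

text \<open>Young's inequality with weight \<open>1 / m\<close> splits each source pairing into
  exactly its share of \<open>source_term\<close> and half of the coercive term. The other half
  absorbs the \<open>\<gamma>\<close> term, and the interface term is a square.\<close>

lemma braces_nonneg:
  assumes "velb R n \<in> X_f D" "headb R n \<in> X_p D"
    and "ff D j (real n * \<Delta>t) \<in> L2 (fm D)" "fp D j (real n * \<Delta>t) \<in> L2 (pm D)"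
    and "m > 0"
    and u: "m * (l2_norm (fm D) (velb R n))\<^sup>2
      \<le> nu D * (l2_norm (fm D) (vgrad (fluid D) (velb R n)))\<^sup>2"
    and p: "m * (l2_norm (pm D) (headb R n))\<^sup>2
      \<le> grav D * (l2_norm (pm D) (\<lambda>x. msqrt (perm D j x) *v wgrad (porous D) (headb R n) x))\<^sup>2"
    and \<gamma>: "\<gamma> \<le> m" "\<gamma> * (grav D * stor D) \<le> m"
  shows "0 \<le> braces D \<Delta>t (1 / m) \<gamma> j R n"
proof -
  let ?t = "real n * \<Delta>t"
  let ?U = "(l2_norm (fm D) (velb R n))\<^sup>2" and ?P = "(l2_norm (pm D) (headb R n))\<^sup>2"
  have "l2_inner (fm D) (ff D j ?t) (velb R n)
      \<le> (1 / m) / 2 * (l2_norm (fm D) (ff D j ?t))\<^sup>2 + m / 2 * ?U"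
    using l2_inner_young[OF _ X_f_square_integrable[OF assms(1)], of "ff D j ?t" "1 / m"] assms(3,5)
    by (simp add: L2_def)
  moreover have "l2_inner (pm D) (\<lambda>x. grav D * fp D j ?t x) (headb R n)
      \<le> (1 / m) / 2 * (l2_norm (pm D) (\<lambda>x. grav D * fp D j ?t x))\<^sup>2 + m / 2 * ?P"
    using l2_inner_young[OF _ X_p_square_integrable[OF assms(2)],
        of "\<lambda>x. grav D * fp D j ?t x" "1 / m"] assms(4,5)
    by (simp add: L2_def power_mult_distrib)
  moreover have "\<gamma> * ?U \<le> m * ?U" "\<gamma> * (grav D * stor D) * ?P \<le> m * ?P"
    using \<gamma> by (auto intro: mult_right_mono)
  moreover have "0 \<le> (l2_norm (gm D) (\<lambda>x. sqrt (eta D j x) * (vtr (fluid D) (velb R n) x \<bullet> tau D x)))\<^sup>2"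
    by simp
  ultimately show ?thesis
    using u p unfolding braces_def source_term_def by (simp only: distrib_left)
qed

end

section \<open>The auxiliary variable\<close>

text \<open>The equation is linear in \<open>r'\<close>, with a positive coefficient and a positive
  right-hand side for every \<open>\<Delta>t > 0\<close>. Here \<open>q\<close> stands for the
  shifted energy, \<open>N\<close> for the braces and \<open>s\<close> for the source. The level
  \<open>b\<close> is invariant because it dominates the equilibrium
  \<open>s / \<gamma> + Cr\<close> of the equation without \<open>N\<close>.\<close>

lemma sav_recursion:
  fixes r r' :: real
  assumes "(r' - r) / \<Delta>t + \<gamma> * r' = - (r' / q) * N + s + \<gamma> * Cr"
    and "\<Delta>t > 0" "\<gamma> > 0" "q > 0" "N \<ge> 0" "s \<ge> 0" "Cr > 0" "r > 0"
  shows "r' > 0" and "r \<le> b \<Longrightarrow> s + \<gamma> * Cr \<le> \<gamma> * b \<Longrightarrow> r' \<le> b"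
proof -
  have eq: "r' * (1 + \<Delta>t * \<gamma> + \<Delta>t * N / q) = r + \<Delta>t * (s + \<gamma> * Cr)"
    using assms(1,2,4) by (simp add: field_simps)
  have "0 < r + \<Delta>t * (s + \<gamma> * Cr)"
    using assms by (intro add_pos_pos mult_pos_pos add_nonneg_pos) auto
  moreover have "0 < 1 + \<Delta>t * \<gamma> + \<Delta>t * N / q"
    using assms by (intro add_pos_nonneg add_pos_pos) auto
  ultimately show pos: "r' > 0"
    by (metis eq zero_less_mult_pos2)
  show "r' \<le> b" if "r \<le> b" "s + \<gamma> * Cr \<le> \<gamma> * b"
  proof -
    \<comment> \<open>Dropping the \<open>N\<close> term leaves the same factor
      \<open>1 + \<Delta>t * \<gamma>\<close> on both sides, so it cancels and no growth in time
      remains.\<close>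
    have "r' * (1 + \<Delta>t * \<gamma>) \<le> r' * (1 + \<Delta>t * \<gamma> + \<Delta>t * N / q)"
      using pos assms by (intro mult_left_mono) auto
    also have "\<dots> \<le> b + \<Delta>t * (\<gamma> * b)"
      unfolding eq using that assms by (intro add_mono mult_left_mono) auto
    finally have "r' * (1 + \<Delta>t * \<gamma>) \<le> b * (1 + \<Delta>t * \<gamma>)"
      by (simp add: algebra_simps)
    then show ?thesis
      using assms by (simp add: add_pos_pos)
  qed
qed

text \<open>The factor \<open>x\<close> splits off as in a geometric sum, whose terms are bounded
  since \<open>\<bar>1 - x\<bar> \<le> 1 + b\<close>. Applied to \<open>xi\<close>, this makes
  \<open>eta_k\<close> decay like the reciprocal of the shifted energy.\<close>

lemma abs_one_minus_power_le:
  fixes x b :: real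
  assumes "0 \<le> x" "x \<le> b"
  shows "\<bar>1 - (1 - x) ^ Suc k\<bar> \<le> real (Suc k) * (1 + b) ^ k * x"
proof -
  have "\<bar>\<Sum>i<Suc k. (1 - x) ^ i\<bar> \<le> (\<Sum>i<Suc k. \<bar>1 - x\<bar> ^ i)"
    by (metis (no_types, lifting) power_abs sum.cong sum_abs)
  also have "\<dots> \<le> (\<Sum>i<Suc k. (1 + b) ^ k)"
  proof (rule sum_mono)
    fix i assume "i \<in> {..<Suc k}"
    then have "\<bar>1 - x\<bar> ^ i \<le> (1 + b) ^ i" "(1 + b) ^ i \<le> (1 + b) ^ k"
      using assms by (auto intro!: power_mono power_increasing)
    then show "\<bar>1 - x\<bar> ^ i \<le> (1 + b) ^ k"
      by linarith
  qed
  finally have "\<bar>\<Sum>i<Suc k. (1 - x) ^ i\<bar> \<le> real (Suc k) * (1 + b) ^ k"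
    by simp
  moreover have "\<bar>1 - (1 - x) ^ Suc k\<bar> = x * \<bar>\<Sum>i<Suc k. (1 - x) ^ i\<bar>"
    using assms(1) by (subst one_diff_power_eq) (simp add: abs_mult)
  ultimately show ?thesis
    using mult_left_mono[of "\<bar>\<Sum>i<Suc k. (1 - x) ^ i\<bar>" "real (Suc k) * (1 + b) ^ k" x] assms(1)
    by (simp only: mult.commute)
qed

lemma le_quadratic:
  fixes a c q :: real
  assumes "c > 0" "c / 2 * a\<^sup>2 + 1 \<le> q"
  shows "a \<le> (1 + 1 / c) * q"
proof -
  \<comment> \<open>This is twice the difference of the sides in the next inequality, written as a
    sum of nonnegative terms.\<close>
  have "0 \<le> (a - 1)\<^sup>2 + 1 + c * a\<^sup>2 + 2 / c"
    using assms(1) by (intro add_nonneg_nonneg) auto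
  then have "a \<le> (1 + 1 / c) * (c / 2 * a\<^sup>2 + 1)"
    using assms(1) by (simp add: field_simps power2_eq_square)
  also have "\<dots> \<le> (1 + 1 / c) * q"
    using assms by (intro mult_left_mono) auto
  finally show ?thesis .
qed

lemma energy_nonneg: "flow_problem D \<Longrightarrow> 0 \<le> energy D u \<phi>"
  using flow_problem.constants[of D] by (simp add: energy_def)

section \<open>Positivity of the auxiliary variable and uniform bounds for the scheme\<close>

theorem theorem3p1:
  fixes D :: flow_data and k j :: nat and \<beta> Cf Cr :: real
  assumes "flow_problem D"
    and "k \<in> {2, 3, 4}" and "\<beta> > 1" and "j \<in> {1..members D}"
    and "Cf > 0"
    and "\<And>t. t \<ge> 0 \<Longrightarrow> ff D j t \<in> L2 (fm D) \<and> l2_norm (fm D) (ff D j t) \<le> Cf"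
    and "\<And>t. t \<ge> 0 \<Longrightarrow> fp D j t \<in> L2 (pm D) \<and> l2_norm (pm D) (fp D j t) \<le> Cf"
    and "Cr \<ge> 1"
  shows "\<exists>\<alpha>>0. \<exists>\<gamma>>0. \<forall>r\<^sub>0>0. \<exists>M>0. \<forall>\<Delta>t>0. \<forall>T>0. \<forall>R.
    gsav_scheme D k \<beta> \<Delta>t T \<alpha> \<gamma> Cr j R \<and> sav R (k - 1) = r\<^sub>0 \<longrightarrow>
      (\<forall>n\<ge>k - 1. real (n + 1) \<le> T / \<Delta>t \<longrightarrow>
        (sav R n > 0 \<longrightarrow> sav R (n + 1) > 0 \<and> xi D Cr R (n + 1) > 0)) \<and>
      (\<forall>n\<ge>k - 1. real (n + 1) \<le> T / \<Delta>t \<longrightarrow>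
        l2_norm (fm D) (vel R (n + 1)) \<le> M \<and> l2_norm (pm D) (head R (n + 1)) \<le> M)"
proof -
  interpret flow_problem D by fact
  obtain m where m: "m > 0"
    "\<And>v. v \<in> X_f D \<Longrightarrow> m * (l2_norm (fm D) v)\<^sup>2 \<le> nu D * (l2_norm (fm D) (vgrad (fluid D) v))\<^sup>2"
    "\<And>\<psi>. \<psi> \<in> X_p D \<Longrightarrow> m * (l2_norm (pm D) \<psi>)\<^sup>2
       \<le> grav D * (l2_norm (pm D) (\<lambda>x. msqrt (perm D j x) *v wgrad (porous D) \<psi> x))\<^sup>2"
    using coercive[OF assms(4)] by blast
  define c where "c = grav D * stor D"
  have c: "c > 0"
    using constants by (simp add: c_def)
  \<comment> \<open>\<open>\<alpha>\<close> is the weight fixed by \<open>braces_nonneg\<close>;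
    dividing by \<open>1 + c\<close> meets both upper bounds on \<open>\<gamma>\<close> required
    there.\<close>
  define \<alpha> where "\<alpha> = 1 / m"
  define \<gamma> where "\<gamma> = m / (1 + c)"
  have \<alpha>: "\<alpha> > 0" and \<gamma>: "\<gamma> > 0" "\<gamma> \<le> m" "\<gamma> * c \<le> m"
    using m(1) c by (auto simp: \<alpha>_def \<gamma>_def field_simps)
  define s where "s = \<alpha> / 2 * (Cf\<^sup>2 + (grav D * Cf)\<^sup>2)"
  have s: "s \<ge> 0"
    using \<alpha> by (simp add: s_def)
  have source: "0 \<le> source_term D \<Delta>t \<alpha> j n \<and> source_term D \<Delta>t \<alpha> j n \<le> s" if "\<Delta>t > 0" for \<Delta>t n
  proof -
    have t: "real n * \<Delta>t \<ge> 0"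
      using that by simp
    have "l2_norm (pm D) (\<lambda>x. grav D * fp D j (real n * \<Delta>t) x) \<le> grav D * Cf"
      using assms(7)[OF t] constants by (simp add: l2_norm_mult)
    then show ?thesis
      unfolding source_term_def s_def using assms(6)[OF t] \<alpha>
      by (intro conjI mult_left_mono add_mono power_mono mult_nonneg_nonneg)
        (auto simp: l2_norm_nonneg)
  qed
  show ?thesis
  proof (rule exI[of _ \<alpha>], intro conjI \<alpha>, rule exI[of _ \<gamma>], intro conjI \<gamma>(1) allI impI)
    fix r\<^sub>0 :: real
    assume r0: "r\<^sub>0 > 0"
    \<comment> \<open>The equilibrium level plus the starting value, so that \<open>b\<close> is
      invariant and lies above the start. It involves neither \<open>T\<close> nor
      \<open>\<Delta>t\<close>.\<close>
    define b where "b = r\<^sub>0 + s / \<gamma> + Cr"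
    have "s / \<gamma> \<ge> 0"
      using s \<gamma>(1) by simp
    then have b: "b > 0" "r\<^sub>0 \<le> b" "s + \<gamma> * Cr \<le> \<gamma> * b"
      using r0 \<gamma>(1) assms(8) by (auto simp: b_def distrib_left)
    define K where "K = real (Suc k) * (1 + b) ^ k"
    have K: "K > 0"
      using b(1) by (simp add: K_def)
    \<comment> \<open>The factor \<open>2 + 1 / c\<close> covers both uses of
      \<open>le_quadratic\<close>: velocity has weight 1 and yields 2, the head has weight
      \<open>c\<close> and yields \<open>1 + 1 / c\<close>.\<close>
    define M where "M = K * b * (2 + 1 / c)"
    show "\<exists>M>0. \<forall>\<Delta>t>0. \<forall>T>0. \<forall>R.
      gsav_scheme D k \<beta> \<Delta>t T \<alpha> \<gamma> Cr j R \<and> sav R (k - 1) = r\<^sub>0 \<longrightarrow>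
        (\<forall>n\<ge>k - 1. real (n + 1) \<le> T / \<Delta>t \<longrightarrow>
          (sav R n > 0 \<longrightarrow> sav R (n + 1) > 0 \<and> xi D Cr R (n + 1) > 0)) \<and>
        (\<forall>n\<ge>k - 1. real (n + 1) \<le> T / \<Delta>t \<longrightarrow>
          l2_norm (fm D) (vel R (n + 1)) \<le> M \<and> l2_norm (pm D) (head R (n + 1)) \<le> M)"
    proof (rule exI[of _ M], intro conjI allI impI; (elim conjE)?)
      show "M > 0"
        using K b(1) c by (simp add: M_def add_pos_pos)
    next
      fix \<Delta>t T :: real and R
      assume dt: "\<Delta>t > 0" and R: "gsav_scheme D k \<beta> \<Delta>t T \<alpha> \<gamma> Cr j R" "sav R (k - 1) = r\<^sub>0"
      have q: "energy D u \<phi> + Cr > 0" for u \<phi>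
        using energy_nonneg[OF assms(1)] assms(8) by (simp add: add_nonneg_pos)
      have step: "gsav_step D k \<beta> \<Delta>t \<alpha> \<gamma> Cr j R n" if "n \<ge> k - 1" "real (n + 1) \<le> T / \<Delta>t" for n
        using R(1) that by (simp add: gsav_scheme_def)
      \<comment> \<open>The upper bound is kept conditional because claim (i) supposes only
        \<open>sav R n > 0\<close>.\<close>
      have rec: "sav R (n + 1) > 0 \<and> (sav R n \<le> b \<longrightarrow> sav R (n + 1) \<le> b)"
        if n: "n \<ge> k - 1" "real (n + 1) \<le> T / \<Delta>t" and r: "sav R n > 0" for n
      proof -
        have t: "real (n + 1) * \<Delta>t \<ge> 0"
          using dt by simp
        have X: "velb R (n + 1) \<in> X_f D" "headb R (n + 1) \<in> X_p D"
          and eq: "sav_eq D \<Delta>t \<alpha> \<gamma> Cr j R n"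
          using step[OF n] by (auto simp: gsav_step_def)
        have N: "0 \<le> braces D \<Delta>t \<alpha> \<gamma> j R (n + 1)"
          unfolding \<alpha>_def using X assms(6,7)[OF t] m \<gamma> by (intro braces_nonneg) (auto simp: c_def)
        have src: "0 \<le> source_term D \<Delta>t \<alpha> j (n + 1)" "source_term D \<Delta>t \<alpha> j (n + 1) \<le> s"
          using source[OF dt] by auto
        have "Cr > 0"
          using assms(8) by simp
        note * = sav_recursion[OF eq[unfolded sav_eq_def] dt \<gamma>(1) q N src(1) this r]
        show ?thesis
          using *(1) *(2)[of b] src(2) b(3) by auto
      qed
      have bound: "sav R n > 0 \<and> sav R n \<le> b" if "n \<ge> k - 1" "real n \<le> T / \<Delta>t" for n
        using that
      proof (induction n rule: dec_induct)
        case base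
        then show ?case using R(2) r0 b(2) by simp
      next
        case (step n)
        then show ?case using rec[of n] by simp
      qed
      show "sav R (n + 1) > 0" "xi D Cr R (n + 1) > 0"
        if "n \<ge> k - 1" "real (n + 1) \<le> T / \<Delta>t" "sav R n > 0" for n
        using rec[OF that] q by (simp_all add: xi_def)
      fix n
      assume n: "n \<ge> k - 1" "real (n + 1) \<le> T / \<Delta>t"
      define Q where "Q = energy D (velb R (n + 1)) (headb R (n + 1)) + Cr"
      have Q: "Q \<ge> 1" "Q > 0"
        using energy_nonneg[OF assms(1), of "velb R (n + 1)" "headb R (n + 1)"] assms(8)
        by (auto simp: Q_def)
      have r: "sav R (n + 1) > 0" "sav R (n + 1) \<le> b"
        using bound[of "n + 1"] n by auto
      have xi: "xi D Cr R (n + 1) = sav R (n + 1) / Q"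
        by (simp add: xi_def Q_def)
      \<comment> \<open>\<open>Cr \<ge> 1\<close> gives \<open>Q \<ge> 1\<close>, so
        \<open>xi\<close> inherits the bound \<open>b\<close>.\<close>
      have "sav R (n + 1) / Q \<le> b"
        using r Q b(1) by (simp add: divide_le_eq) (smt (verit) mult_le_cancel_left1)
      then have "\<bar>eta_k D k Cr R (n + 1)\<bar> \<le> K * (sav R (n + 1) / Q)"
        unfolding eta_k_def xi K_def Suc_eq_plus1[of k, symmetric]
        using r(1) Q by (intro abs_one_minus_power_le) auto
      also have "\<dots> \<le> K * (b / Q)"
        using K r Q by (intro mult_left_mono divide_right_mono) auto
      finally have eta: "\<bar>eta_k D k Cr R (n + 1)\<bar> \<le> K * (b / Q)" .
      \<comment> \<open>The factor \<open>1 / Q\<close> from \<open>eta_k\<close> cancels the growth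
        of the uncorrected norm \<open>a\<close>, which is at most linear in
        \<open>Q\<close>.\<close>
      have final: "l \<le> M" if "l \<le> \<bar>eta_k D k Cr R (n + 1)\<bar> * a" "0 \<le> a" "a \<le> (2 + 1 / c) * Q" for l a
      proof -
        have "l \<le> K * (b / Q) * ((2 + 1 / c) * Q)"
          using that(1) mult_mono[OF eta that(3)] that(2) K b(1) Q by simp
        then show ?thesis
          using Q by (simp add: M_def)
      qed
      have S: "velb R (n + 1) \<in> X_f D" "headb R (n + 1) \<in> X_p D"
        "AE x in fm D. vel R (n + 1) x = eta_k D k Cr R (n + 1) *\<^sub>R velb R (n + 1) x"
        "AE x in pm D. head R (n + 1) x = eta_k D k Cr R (n + 1) *\<^sub>R headb R (n + 1) x"
        using step[OF n] by (auto simp: gsav_step_def)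
      have E: "Q = (l2_norm (fm D) (velb R (n + 1)))\<^sup>2 / 2
          + c / 2 * (l2_norm (pm D) (headb R (n + 1)))\<^sup>2 + Cr"
        by (simp add: Q_def energy_def c_def)
      have "0 \<le> c / 2 * (l2_norm (pm D) (headb R (n + 1)))\<^sup>2"
        using c by simp
      then have "1 / 2 * (l2_norm (fm D) (velb R (n + 1)))\<^sup>2 + 1 \<le> Q"
        using E assms(8) by simp
      \<comment> \<open>The weight is 1 here, so the factor is 2; the surplus \<open>Q / c\<close>
        is nonnegative.\<close>
      from le_quadratic[OF _ this] have "l2_norm (fm D) (velb R (n + 1)) \<le> (2 + 1 / c) * Q"
        using Q c by (simp add: algebra_simps) (smt (verit) divide_nonneg_pos)
      then show "l2_norm (fm D) (vel R (n + 1)) \<le> M"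
        by (rule final[OF l2_norm_AE_scaleR_le[OF S(3) X_f_square_integrable[OF S(1)]] l2_norm_nonneg])
      have "c / 2 * (l2_norm (pm D) (headb R (n + 1)))\<^sup>2 + 1 \<le> Q"
        using E assms(8) zero_le_power2[of "l2_norm (fm D) (velb R (n + 1))"] by linarith
      from le_quadratic[OF c this] have "l2_norm (pm D) (headb R (n + 1)) \<le> (2 + 1 / c) * Q"
        using Q by (simp add: algebra_simps)
      then show "l2_norm (pm D) (head R (n + 1)) \<le> M"
        by (rule final[OF l2_norm_AE_scaleR_le[OF S(4) X_p_square_integrable[OF S(2)]] l2_norm_nonneg])
    qed
  qed
qed

end
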